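(* Let $X_n$ and $Y_n$ be the area and the roughness (number of peaks), respectively, of a uniformly random Dyck path $P\in\mathcal D_n$. Then, as $n\to\infty$, $$\mathrm{Corr}(X_n,Y_n) = -\frac{1}{\sqrt{2}\,\sqrt{\frac{10}{3\pi}-1}}\; n^{-1/2} + O\big(n^{-1}\big).$$
   Context: A Dyck path of half-length $n$ is a lattice path from $(0,0)$ to $(n,n)$ consisting of $n$ horizontal steps East (E) from $(i,j)$ to $(i+1,j)$ and $n$ vertical steps North (N) from $(i,j)$ to $(i,j+1)$, such that all points $(i,j)$ on the path satisfy $i\le j$ (the path stays on or above the line $y=x$). $\mathcal D_n$ denotes the set of all Dyck paths of half-length $n$; its cardinality is the Catalan number $C_n=\frac{1}{n+1}\binom{2n}{n}$. A peak of $P$ is an occurrence of two consecutive steps $NE$ in $P$; the roughness of $P$, denoted $pk(P)$, is the number of peaks of $P$. The area $a(P)$ is the number of whole unit squares (with integer-coordinate corners) lying below the path $P$ and above the line $y=x$. (For example, $P=NNNEEENNEE$ has $pk(P)=2$ and $a(P)=4$.) For $P$ chosen uniformly at random from $\mathcal D_n$, set $X_n=a(P)$ and $Y_n=pk(P)$. The correlation coefficient is $\mathrm{Corr}(\xi,\eta)=\mathrm{Cov}(\xi,\eta)/\sqrt{\mathrm{Var}(\xi)\mathrm{Var}(\eta)}$. *)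

theory Defs
  imports "HOL-Probability.Probability" "HOL-Library.Landau_Symbols"
begin

datatype step = North | East

instance step :: finite
proof
  have "(UNIV :: step set) = {North, East}"
    using step.exhaust by auto
  then show "finite (UNIV :: step set)"
    by (metis finite.emptyI finite.insertI)
qed

text \<open>The lattice point reached from the origin after the first \<open>k\<close> steps.\<close>

definition path_point :: "step list \<Rightarrow> nat \<Rightarrow> nat \<times> nat" where
  "path_point P k = (count_list (take k P) East, count_list (take k P) North)"

definition dyck_paths :: "nat \<Rightarrow> step list set" where
  "dyck_paths n =
     {P. path_point P (length P) = (n, n) \<and>
         (\<forall>k \<le> length P. fst (path_point P k) \<le> snd (path_point P k))}"

definition peaks :: "step list \<Rightarrow> nat" where
  "peaks P = card {k. Suc k < length P \<and> P ! k = North \<and> P ! Suc k = East}"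

text \<open>A unit square is represented by its lower left corner \<open>(i, j)\<close>. It lies above the
  line \<open>y = x\<close> iff its lower right corner \<open>(i + 1, j)\<close> does. It lies below the path iff the
  East step of the path from abscissa \<open>i\<close> to \<open>i + 1\<close> has height at least \<open>j + 1\<close>.\<close>

definition square_above_diagonal :: "nat \<times> nat \<Rightarrow> bool" where
  "square_above_diagonal = (\<lambda>(i, j). i + 1 \<le> j)"

definition square_below_path :: "step list \<Rightarrow> nat \<times> nat \<Rightarrow> bool" where
  "square_below_path P = (\<lambda>(i, j).
     \<exists>k < length P. P ! k = East \<and> fst (path_point P k) = i \<and> j + 1 \<le> snd (path_point P k))"

definition area :: "step list \<Rightarrow> nat" where
  "area P = card {s. square_above_diagonal s \<and> square_below_path P s}"

definition random_dyck_path :: "nat \<Rightarrow> step list pmf" where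
  "random_dyck_path n = pmf_of_set (dyck_paths n)"

definition covariance :: "'a pmf \<Rightarrow> ('a \<Rightarrow> real) \<Rightarrow> ('a \<Rightarrow> real) \<Rightarrow> real" where
  "covariance p X Y = measure_pmf.expectation p
     (\<lambda>x. (X x - measure_pmf.expectation p X) * (Y x - measure_pmf.expectation p Y))"

definition correlation :: "'a pmf \<Rightarrow> ('a \<Rightarrow> real) \<Rightarrow> ('a \<Rightarrow> real) \<Rightarrow> real" where
  "correlation p X Y =
     covariance p X Y / sqrt (measure_pmf.variance p X * measure_pmf.variance p Y)"

text \<open>\<open>pmf_of_set\<close> is the uniform distribution only on finite nonempty sets.\<close>

lemma finite_dyck_paths: "finite (dyck_paths n)"
proof (rule finite_subset)
  have len: "length P = count_list P East + count_list P North" for P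
    by (induction P) (auto split: if_splits, metis step.exhaust)
  show "dyck_paths n \<subseteq> {P. set P \<subseteq> UNIV \<and> length P = 2 * n}"
    by (auto simp: dyck_paths_def path_point_def len)
  show "finite {P :: step list. set P \<subseteq> UNIV \<and> length P = 2 * n}"
    by (rule finite_lists_length_eq) simp
qed

lemma dyck_paths_nonempty: "dyck_paths n \<noteq> {}"
proof -
  have c: "count_list (replicate m a) b = (if a = b then m else 0)" for m and a b :: step
    by (induction m) auto
  have "replicate n North @ replicate n East \<in> dyck_paths n"
    by (auto simp: dyck_paths_def path_point_def c min_def)
  then show ?thesis by blast
qed

lemma area_peaks_example:
  defines "P \<equiv> [North, North, North, East, East, East, North, North, East, East]"
  shows "P \<in> dyck_paths 5" "peaks P = 2" "area P = 4"
proof -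
  have len: "length P = 10" by (simp add: P_def)
  have le: "k \<le> 10 \<longleftrightarrow> k \<in> {0,1,2,3,4,5,6,7,8,9,10}" and
       lt: "k < 10 \<longleftrightarrow> k \<in> {0,1,2,3,4,5,6,7,8,9}" for k :: nat
    unfolding insert_iff empty_iff by presburger+
  show "P \<in> dyck_paths 5"
    unfolding dyck_paths_def mem_Collect_eq len le by (auto simp: P_def path_point_def)
  have "{k. Suc k < length P \<and> P ! k = North \<and> P ! Suc k = East} = {2, 7}"
    by (auto simp: P_def nth_Cons' less_Suc_eq split: if_splits)
  then show "peaks P = 2" by (simp add: peaks_def)
  have "{s. square_above_diagonal s \<and> square_below_path P s} = {(0,1), (0,2), (1,2), (3,4)}"
  proof -
    have *: "square_below_path P (i, j) \<longleftrightarrow>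
        (\<exists>k \<in> {0,1,2,3,4,5,6,7,8,9}. P ! k = East \<and> fst (path_point P k) = i
           \<and> j + 1 \<le> snd (path_point P k))" for i j
      unfolding square_below_path_def len lt by blast
    have below: "square_below_path P (i, j) \<longleftrightarrow>
        i = 0 \<and> j < 3 \<or> i = 1 \<and> j < 3 \<or> i = 2 \<and> j < 3 \<or> i = 3 \<and> j < 5 \<or> i = 4 \<and> j < 5" for i j
      unfolding * by (simp add: P_def path_point_def Suc_le_eq numeral_eq_Suc) blast
    have lt_conv: "j < 3 \<longleftrightarrow> j = 0 \<or> j = 1 \<or> j = 2"
      "j < 5 \<longleftrightarrow> j = 0 \<or> j = 1 \<or> j = 2 \<or> j = 3 \<or> j = 4" for j :: nat
      by presburger+
    show ?thesis
      by (auto simp: square_above_diagonal_def below lt_conv)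
  qed
  then show "area P = 4" by (simp add: area_def)
qed

end

theory Submission
  imports Defs "HOL-Real_Asymp.Real_Asymp"
begin

text \<open>
  Both the covariance and the two variances can be computed exactly for every \<open>n \<ge> 1\<close>, and the
  asymptotic statement is then read off from the exact values.

  A nonempty Dyck path factors uniquely at its first return to the diagonal as
  \<open>N P E Q\<close> with Dyck paths \<open>P\<close>, \<open>Q\<close>. Along this factorisation area and number of peaks are
  additive up to simple corrections: the area gains the half-length of \<open>P\<close>, because \<open>P\<close> is
  lifted by one unit (\<open>area_first_return\<close>), and a new peak arises only if \<open>P\<close> is empty
  (\<open>peaks_first_return\<close>). Hence the generating functions of
  \<open>1\<close>, \<open>a\<close>, \<open>pk\<close>, \<open>a\<^sup>2\<close>, \<open>pk\<^sup>2\<close> and \<open>a \<cdot> pk\<close> summed over Dyck paths satisfy a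
  quadratic equation (for \<open>1\<close>) and then linear equations with the same coefficient
  \<open>1 - 2xC(x) = s\<close>, where \<open>s = sqrt (1 - 4x)\<close>. Solving them one after the other
  expresses everything, after a further factor \<open>x\<close> for \<open>1\<close>, \<open>a\<close> and \<open>a\<^sup>2\<close>, as a Laurent polynomial in
  \<open>s\<close> with explicit coefficients.

  With \<open>r = 4\<^sup>n / binom(2n, n)\<close>, which is the partial Wallis product \<open>wallis_ratio n\<close>, the result is
  \<open>Cov(a, pk) = - (n + 1) (r - 2) / 8\<close>,
  \<open>Var(pk) = (n + 1) (n - 1) / (4 (2n - 1))\<close> and
  \<open>Var(a) = (n + 1) (2n + 1) (5n + 3) / 12 - (n + 1)\<^sup>2 r\<^sup>2 / 4\<close>
  (\<open>covariance_area_peaks\<close>, \<open>variance_peaks\<close>, \<open>variance_area\<close>). Here the leading terms, of order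
  \<open>n\<^bsup>5/2\<^esup>\<close>, of \<open>E(a \<cdot> pk)\<close> and \<open>E(a) E(pk)\<close> cancel and leave order \<open>n\<^bsup>3/2\<^esup>\<close>,
  while the product of the standard deviations has order \<open>n\<^sup>2\<close>.

  Finally \<open>\<pi> n \<le> r\<^sup>2 \<le> \<pi> (n + 1/2)\<close> by the Wallis product (\<open>wallis_ratio_bounds\<close>). So
  \<open>- Cov / n\<^bsup>3/2\<^esup>\<close> and \<open>Var(a) Var(pk) / n\<^sup>4\<close> converge to \<open>sqrt \<pi> / 8\<close> and
  \<open>(5/6 - \<pi>/4) / 8\<close> with error \<open>O(n\<^bsup>-1/2\<^esup>)\<close>. The second limit is positive because
  \<open>\<pi> < 10/3\<close>, so the quotient of the first by the square root of the second inherits the error,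
  and the remaining factor \<open>n\<^bsup>-1/2\<^esup>\<close> of the correlation turns it into \<open>O(1/n)\<close>.
\<close>

unbundle no vec_syntax
unbundle fps_syntax

section \<open>Dyck paths and their first return\<close>

text \<open>A Dyck path read from a point at height \<open>d\<close> above the diagonal down to the diagonal. Unlike
  the condition on all prefixes, this form allows structural induction, and the parameter \<open>d\<close>
  is what lets statements about pieces of a path be generalised.\<close>

fun dyck_from :: "nat \<Rightarrow> step list \<Rightarrow> bool" where
  "dyck_from d [] \<longleftrightarrow> d = 0"
| "dyck_from d (North # P) \<longleftrightarrow> dyck_from (Suc d) P"
| "dyck_from d (East # P) \<longleftrightarrow> 0 < d \<and> dyck_from (d - 1) P"

lemma dyck_from_iff:
  "dyck_from d P \<longleftrightarrow>
     count_list P East = d + count_list P North \<and>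
     (\<forall>k\<le>length P. count_list (take k P) East \<le> d + count_list (take k P) North)"
proof (induction d P rule: dyck_from.induct)
  case (1 d)
  then show ?case by auto
next
  case (2 d P)
  have split: "(\<forall>k\<le>Suc m. Q k) \<longleftrightarrow> Q 0 \<and> (\<forall>k\<le>m. Q (Suc k))" for m :: nat and Q
    by (metis Suc_le_mono le0 not0_implies_Suc)
  show ?case by (simp add: 2 split)
next
  case (3 d P)
  have split: "(\<forall>k\<le>Suc m. Q k) \<longleftrightarrow> Q 0 \<and> (\<forall>k\<le>m. Q (Suc k))" for m :: nat and Q
    by (metis Suc_le_mono le0 not0_implies_Suc)
  show ?case
  proof (cases d)
    case 0
    then show ?thesis by (auto simp: split intro!: exI[of _ 0])
  next
    case (Suc e)
    then show ?thesis using 3 by (simp add: split)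
  qed
qed

lemma dyck_paths_eq: "dyck_paths n = {P. dyck_from 0 P \<and> count_list P North = n}"
  by (auto simp: dyck_paths_def path_point_def dyck_from_iff)

lemma dyck_from_count: "dyck_from d P \<Longrightarrow> count_list P East = d + count_list P North"
  by (simp add: dyck_from_iff)

lemma dyck_from_append:
  "dyck_from d P \<Longrightarrow> dyck_from e Q \<Longrightarrow> dyck_from (d + e) (P @ Q)"
  by (induction d P rule: dyck_from.induct) auto

text \<open>A path from height \<open>d + 1\<close> must reach height \<open>d\<close>; \<open>Q\<close> is the part before the first East step
  that does so. A leading North step has to be undone twice, whence the two uses of the induction
  hypothesis on ever shorter tails.\<close>

lemma first_return_exists:
  "dyck_from (Suc d) P \<Longrightarrow> \<exists>Q R. P = Q @ East # R \<and> dyck_from 0 Q \<and> dyck_from d R"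
proof (induction P arbitrary: d rule: length_induct)
  case (1 P)
  show ?case
  proof (cases "(Suc d, P)" rule: dyck_from.cases)
    case (1 d)
    then show ?thesis using "1.prems" by simp
  next
    case (2 e P')
    then have P: "P = North # P'" and "dyck_from (Suc (Suc d)) P'"
      using "1.prems" by auto
    then obtain Q1 R1 where P': "P' = Q1 @ East # R1" and Q1: "dyck_from 0 Q1"
      and R1: "dyck_from (Suc d) R1"
      using "1.IH"[rule_format, of P' "Suc d"] P by auto
    moreover have "length R1 < length P" by (simp add: P P')
    ultimately obtain Q2 R2 where R1': "R1 = Q2 @ East # R2" and Q2: "dyck_from 0 Q2"
      and R2: "dyck_from d R2"
      using "1.IH" by blast
    have "dyck_from (0 + 1) (Q1 @ East # Q2)"
      using Q1 Q2 by (intro dyck_from_append) auto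
    then have "dyck_from 0 (North # Q1 @ East # Q2)" by simp
    moreover have "P = (North # Q1 @ East # Q2) @ East # R2" by (simp add: P P' R1')
    ultimately show ?thesis using R2 by blast
  next
    case (3 e P')
    then have "P = [] @ East # P'" "dyck_from d P'"
      using "1.prems" by auto
    then show ?thesis using dyck_from.simps(1) by blast
  qed
qed

text \<open>The last step would go below the diagonal. This is what makes the factorisation at the first
  return unique.\<close>

lemma not_dyck_from_beyond_return:
  "dyck_from d Q \<Longrightarrow> \<not> dyck_from d (Q @ East # S)"
  by (induction d Q rule: dyck_from.induct) auto

lemma first_return_unique:
  assumes "Q @ East # R = Q' @ East # R'" "dyck_from 0 Q" "dyck_from 0 Q'"
  shows "Q = Q' \<and> R = R'"
proof -
  from assms(1) obtain U where
    "Q = Q' @ U \<and> U @ East # R = East # R' \<or> Q @ U = Q' \<and> East # R = U @ East # R'"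
    by (auto simp: append_eq_append_conv2)
  then show ?thesis
    using not_dyck_from_beyond_return assms(2,3) by (cases U) fastforce+
qed

lemma sum_dyck_paths_Suc:
  "(\<Sum>P\<in>dyck_paths (Suc n). f P) =
     (\<Sum>k\<le>n. \<Sum>P\<in>dyck_paths k. \<Sum>Q\<in>dyck_paths (n - k). f (North # P @ East # Q))"
proof -
  \<comment> \<open>the index \<open>k\<close> is the half-length of the first factor\<close>
  define S where "S = (SIGMA k:{..n}. dyck_paths k \<times> dyck_paths (n - k))"
  define join :: "nat \<times> step list \<times> step list \<Rightarrow> step list"
    where "join = (\<lambda>(k, P, Q). North # P @ East # Q)"
  have "inj_on join S"
    by (auto simp: inj_on_def join_def S_def dyck_paths_eq dest!: first_return_unique)
  moreover have "join ` S = dyck_paths (Suc n)"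
  proof (intro equalityI subsetI)
    fix P assume "P \<in> join ` S"
    then obtain k Q R where P: "P = North # Q @ East # R" and "k \<le> n"
      and QR: "Q \<in> dyck_paths k" "R \<in> dyck_paths (n - k)"
      by (auto simp: join_def S_def)
    moreover have "dyck_from (0 + 1) (Q @ East # R)"
      using QR by (intro dyck_from_append) (auto simp: dyck_paths_eq)
    ultimately show "P \<in> dyck_paths (Suc n)"
      by (auto simp: dyck_paths_eq)
  next
    fix P assume P: "P \<in> dyck_paths (Suc n)"
    then obtain P' where P': "P = North # P'" "dyck_from (Suc 0) P'"
      by (cases "(0 :: nat, P)" rule: dyck_from.cases) (auto simp: dyck_paths_eq)
    then obtain Q R where "P = North # Q @ East # R" "dyck_from 0 Q" "dyck_from 0 R"
      using first_return_exists by blast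
    then have "(count_list Q North, Q, R) \<in> S" "P = join (count_list Q North, Q, R)"
      using P by (auto simp: dyck_paths_eq S_def join_def)
    then show "P \<in> join ` S" by blast
  qed
  ultimately have "(\<Sum>P\<in>dyck_paths (Suc n). f P) = (\<Sum>x\<in>S. f (join x))"
    by (metis (no_types, lifting) sum.reindex_cong)
  also have "\<dots> = (\<Sum>k\<le>n. \<Sum>(P, Q)\<in>dyck_paths k \<times> dyck_paths (n - k). f (North # P @ East # Q))"
    unfolding S_def join_def
    by (subst sum.Sigma) (auto simp: finite_dyck_paths intro!: sum.cong)
  finally show ?thesis by (simp add: sum.cartesian_product)
qed

lemma peaks_Nil [simp]: "peaks [] = 0"
  by (simp add: peaks_def)

lemma peaks_Cons:
  "peaks (x # P) = (if x = North \<and> P \<noteq> [] \<and> hd P = East then 1 else 0) + peaks P"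
proof -
  let ?K = "{k. Suc k < length P \<and> P ! k = North \<and> P ! Suc k = East}"
  have "{k. Suc k < length (x # P) \<and> (x # P) ! k = North \<and> (x # P) ! Suc k = East} =
      (if x = North \<and> P \<noteq> [] \<and> hd P = East then {0} else {}) \<union> Suc ` ?K" (is "?L = ?R")
  proof (rule set_eqI)
    fix k show "k \<in> ?L \<longleftrightarrow> k \<in> ?R"
      by (cases k) (auto simp: hd_conv_nth)
  qed
  moreover have "finite ?K" by (rule finite_subset[of _ "{..<length P}"]) auto
  ultimately show ?thesis
    by (auto simp: peaks_def card_image card_insert_if)
qed

lemma peaks_append_East:
  "(P \<noteq> [] \<Longrightarrow> last P = East) \<Longrightarrow> peaks (P @ East # Q) = peaks P + peaks Q"
  by (induction P) (auto simp: peaks_Cons hd_append)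

lemma last_dyck_from: "dyck_from d P \<Longrightarrow> P \<noteq> [] \<Longrightarrow> last P = East"
  by (induction d P rule: dyck_from.induct) (auto split: if_splits)

text \<open>Peaks inside the factors survive, and the separating East step closes a new peak only if it
  follows the initial North step directly: a nonempty \<open>P\<close> ends with East.\<close>

lemma peaks_first_return:
  assumes "dyck_from 0 P"
  shows "peaks (North # P @ East # Q) = peaks P + peaks Q + (if P = [] then 1 else 0)"
proof -
  have "P \<noteq> [] \<Longrightarrow> hd P = North"
    using assms by (cases "(0 :: nat, P)" rule: dyck_from.cases) auto
  then show ?thesis
    using peaks_append_East[of P Q] last_dyck_from[OF assms]
    by (subst peaks_Cons) (auto simp: hd_append)
qed

text \<open>An East step that starts at height \<open>d\<close> above the diagonal has \<open>d - 1\<close> whole squares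
  between itself and the diagonal.\<close>

fun area_from :: "nat \<Rightarrow> step list \<Rightarrow> nat" where
  "area_from d [] = 0"
| "area_from d (North # P) = area_from (Suc d) P"
| "area_from d (East # P) = (d - 1) + area_from (d - 1) P"

lemma area_from_eq_sum:
  "dyck_from d P \<Longrightarrow> area_from d P =
     (\<Sum>k<length P. if P ! k = East
        then d + count_list (take k P) North - Suc (count_list (take k P) East) else 0)"
proof (induction d P rule: dyck_from.induct)
  case (3 d P)
  then obtain e where "d = Suc e" by (cases d) auto
  with 3 show ?case by (simp add: sum.lessThan_Suc_shift del: sum.lessThan_Suc cong: if_cong)
qed (simp_all add: sum.lessThan_Suc_shift del: sum.lessThan_Suc cong: if_cong)

lemma count_list_take_less:
  assumes "k < l" "l \<le> length P" "P ! k = x"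
  shows "count_list (take k P) x < count_list (take l P) x"
proof -
  have "take l P = take (Suc k) P @ drop (Suc k) (take l P)"
    using assms by (metis Suc_leI append_take_drop_id min.absorb1 take_take)
  then have "count_list (take l P) x \<ge> count_list (take (Suc k) P) x"
    by (metis count_list_append le_add1)
  then show ?thesis using assms by (simp add: take_Suc_conv_app_nth)
qed

text \<open>The squares are counted column by column: different East steps lie over different columns.\<close>

lemma area_eq_sum:
  "area P = (\<Sum>k<length P. if P ! k = East
     then count_list (take k P) North - Suc (count_list (take k P) East) else 0)"
proof -
  define K where "K = {k. k < length P \<and> P ! k = East}"
  define i where "i k = count_list (take k P) East" for k
  define h where "h k = count_list (take k P) North" for k
  have "i k \<noteq> i l" if "k \<in> K" "l \<in> K" "k \<noteq> l" for k l
    using that count_list_take_less[of k l P East] count_list_take_less[of l k P East]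
    by (cases k l rule: linorder_cases) (auto simp: K_def i_def)
  then have "card (\<Union>k\<in>K. {i k} \<times> {Suc (i k)..<h k}) = (\<Sum>k\<in>K. card ({i k} \<times> {Suc (i k)..<h k}))"
    by (intro card_UN_disjoint) (auto simp: K_def)
  moreover have "{s. square_above_diagonal s \<and> square_below_path P s} =
      (\<Union>k\<in>K. {i k} \<times> {Suc (i k)..<h k})"
    by (auto simp: square_above_diagonal_def square_below_path_def K_def i_def h_def path_point_def)
  ultimately have "area P = (\<Sum>k\<in>K. h k - Suc (i k))"
    by (simp add: area_def card_cartesian_product)
  also have "\<dots> = (\<Sum>k<length P. if P ! k = East then h k - Suc (i k) else 0)"
    unfolding K_def by (rule sum.mono_neutral_cong_left) auto
  finally show ?thesis by (simp add: i_def h_def cong: if_cong)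
qed

lemma area_eq_area_from: "dyck_from 0 P \<Longrightarrow> area P = area_from 0 P"
  using area_from_eq_sum[of 0 P] by (simp add: area_eq_sum cong: if_cong)

text \<open>Raising a path by \<open>e\<close> adds \<open>e\<close> squares in each of its columns.\<close>

lemma area_from_append:
  "dyck_from d P \<Longrightarrow>
     area_from (d + e) (P @ Q) = area_from d P + e * count_list P East + area_from e Q"
  by (induction d P rule: dyck_from.induct) (auto simp: gr0_conv_Suc)

lemma area_first_return:
  assumes "dyck_from 0 P" "dyck_from 0 Q"
  shows "area (North # P @ East # Q) = area P + area Q + count_list P North"
proof -
  have "dyck_from (0 + 1) (P @ East # Q)"
    using assms by (intro dyck_from_append) auto
  then have "dyck_from 0 (North # P @ East # Q)" by simp
  then have "area (North # P @ East # Q) = area_from (0 + 1) (P @ East # Q)"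
    by (simp add: area_eq_area_from)
  also have "\<dots> = area P + area Q + count_list P North"
    using assms by (subst area_from_append)
      (auto simp: area_eq_area_from dyck_from_count)
  finally show ?thesis .
qed

section \<open>Generating functions over Dyck paths\<close>

definition gf :: "(step list \<Rightarrow> real) \<Rightarrow> real fps" where
  "gf f = Abs_fps (\<lambda>n. \<Sum>P\<in>dyck_paths n. f P)"

text \<open>The generating function of a weight on pairs of Dyck paths, by total half-length; it turns a
  weight of the form \<open>g P * h Q\<close> into a product of power series.\<close>

definition pair_gf :: "(step list \<Rightarrow> step list \<Rightarrow> real) \<Rightarrow> real fps" where
  "pair_gf g = Abs_fps (\<lambda>n. \<Sum>k\<le>n. \<Sum>P\<in>dyck_paths k. \<Sum>Q\<in>dyck_paths (n - k). g P Q)"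

text \<open>The operator \<open>x d/dx\<close>, which multiplies the weight of a path by its half-length.\<close>

definition euler :: "real fps \<Rightarrow> real fps" where
  "euler F = fps_X * fps_deriv F"

lemma dyck_paths_0: "dyck_paths 0 = {[]}"
proof -
  have "P = []" if "dyck_from 0 P" "count_list P North = 0" for P
    using that by (cases "(0 :: nat, P)" rule: dyck_from.cases) auto
  then show ?thesis by (auto simp: dyck_paths_eq)
qed

text \<open>The factor \<open>x\<close> accounts for the North and East step that the factorisation removes.\<close>

lemma gf_first_return:
  assumes "\<And>P Q. dyck_from 0 P \<Longrightarrow> dyck_from 0 Q \<Longrightarrow> f (North # P @ East # Q) = g P Q"
  shows "gf f = fps_const (f []) + fps_X * pair_gf g"
proof (rule fps_ext)
  fix n
  show "gf f $ n = (fps_const (f []) + fps_X * pair_gf g) $ n"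
  proof (cases n)
    case 0
    then show ?thesis by (simp add: gf_def dyck_paths_0)
  next
    case (Suc m)
    have "gf f $ Suc m =
        (\<Sum>k\<le>m. \<Sum>P\<in>dyck_paths k. \<Sum>Q\<in>dyck_paths (m - k). f (North # P @ East # Q))"
      by (simp add: gf_def sum_dyck_paths_Suc)
    also have "\<dots> = pair_gf g $ m"
      using assms by (auto simp: pair_gf_def dyck_paths_eq intro!: sum.cong)
    finally show ?thesis by (simp add: Suc)
  qed
qed

lemma gf_first_return_0:
  assumes "f [] = 0"
    and "\<And>P Q. dyck_from 0 P \<Longrightarrow> dyck_from 0 Q \<Longrightarrow> f (North # P @ East # Q) = g P Q"
  shows "gf f = fps_X * pair_gf g"
  using gf_first_return[of f g] assms by simp

lemma pair_gf_add: "pair_gf (\<lambda>P Q. g P Q + h P Q) = pair_gf g + pair_gf h"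
  by (rule fps_ext) (simp add: pair_gf_def sum.distrib)

lemma pair_gf_mult: "pair_gf (\<lambda>P Q. g P * h Q) = gf g * gf h"
  by (rule fps_ext) (simp add: pair_gf_def gf_def fps_mult_nth atLeast0AtMost sum_product)

lemma gf_size_mult: "gf (\<lambda>P. real (count_list P North) * f P) = euler (gf f)"
proof (rule fps_ext)
  fix n show "gf (\<lambda>P. real (count_list P North) * f P) $ n = euler (gf f) $ n"
    by (cases n) (auto simp: gf_def euler_def dyck_paths_eq sum_distrib_left intro!: sum.cong)
qed

lemma gf_size_square:
  "gf (\<lambda>P. real (count_list P North) * real (count_list P North)) = euler (euler (gf (\<lambda>_. 1)))"
  "gf (\<lambda>P. real (count_list P North)) = euler (gf (\<lambda>_. 1))"
  using gf_size_mult[of "\<lambda>P. real (count_list P North)"] gf_size_mult[of "\<lambda>_. 1"] by simp_all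

definition empty_indicator :: "step list \<Rightarrow> real" where
  "empty_indicator P = (if P = [] then 1 else 0)"

lemma gf_empty_indicator: "gf empty_indicator = 1"
proof (rule fps_ext)
  fix n show "gf empty_indicator $ n = 1 $ n"
    by (cases n) (simp add: gf_def dyck_paths_0 empty_indicator_def,
      auto simp: gf_def dyck_paths_eq empty_indicator_def intro!: sum.neutral)
qed

abbreviation count_gf where "count_gf \<equiv> gf (\<lambda>_. 1)"
abbreviation area_gf where "area_gf \<equiv> gf (\<lambda>P. real (area P))"
abbreviation peaks_gf where "peaks_gf \<equiv> gf (\<lambda>P. real (peaks P))"
abbreviation area_sq_gf where "area_sq_gf \<equiv> gf (\<lambda>P. real (area P) ^ 2)"
abbreviation peaks_sq_gf where "peaks_sq_gf \<equiv> gf (\<lambda>P. real (peaks P) ^ 2)"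
abbreviation area_peaks_gf where "area_peaks_gf \<equiv> gf (\<lambda>P. real (area P) * real (peaks P))"

lemma area_Nil: "area [] = 0"
  by (simp add: area_eq_sum)

lemma area_first_return_real:
  "dyck_from 0 P \<Longrightarrow> dyck_from 0 Q \<Longrightarrow>
    real (area (North # P @ East # Q)) = real (area P) + real (area Q) + real (count_list P North)"
  by (simp add: area_first_return)

lemma peaks_first_return_real:
  "dyck_from 0 P \<Longrightarrow>
    real (peaks (North # P @ East # Q)) = real (peaks P) + real (peaks Q) + empty_indicator P"
  by (simp add: peaks_first_return empty_indicator_def)

text \<open>Expanding the weight of \<open>N P E Q\<close> into a sum of products of a weight of \<open>P\<close> and a weight of
  \<open>Q\<close>, these rules translate the factorisation into an equation between power series. In the
  proofs below, the trivial factors \<open>1\<close> are written out to put every summand into this form.\<close>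

lemmas pair_gf_simps = pair_gf_add pair_gf_mult gf_size_mult gf_size_square gf_empty_indicator

lemma count_gf_eq: "count_gf = 1 + fps_X * (count_gf * count_gf)"
  using gf_first_return[of "\<lambda>_. 1" "\<lambda>P Q. 1 * 1"] pair_gf_mult[of "\<lambda>_. 1" "\<lambda>_. 1"] by simp

lemma area_gf_eq:
  "area_gf = fps_X * (area_gf * count_gf + count_gf * area_gf + euler count_gf * count_gf)"
proof -
  have "area_gf = fps_X * pair_gf (\<lambda>P Q.
      real (area P) * 1 + 1 * real (area Q) + real (count_list P North) * 1)"
    by (rule gf_first_return_0, simp add: area_Nil) (simp add: area_first_return)
  then show ?thesis
    by (rule trans) (simp only: pair_gf_simps)
qed

lemma peaks_gf_eq:
  "peaks_gf = fps_X * (peaks_gf * count_gf + count_gf * peaks_gf + count_gf)"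
proof -
  have "peaks_gf = fps_X * pair_gf (\<lambda>P Q.
      real (peaks P) * 1 + 1 * real (peaks Q) + empty_indicator P * 1)"
    by (rule gf_first_return_0, simp)
      (simp only: peaks_first_return_real mult_1 mult_1_right)
  then show ?thesis
    by (rule trans) (simp only: pair_gf_simps, algebra)
qed

text \<open>The empty path has no peaks, so the mixed term of \<open>empty_indicator P\<close> and \<open>peaks P\<close> is zero;
  moreover \<open>empty_indicator\<close> is its own square.\<close>

lemma peaks_sq_gf_eq:
  "peaks_sq_gf = fps_X * (peaks_sq_gf * count_gf + count_gf * peaks_sq_gf + count_gf
     + 2 * (peaks_gf * peaks_gf) + 2 * peaks_gf)"
proof -
  have "peaks_sq_gf = fps_X * pair_gf (\<lambda>P Q.
      real (peaks P) ^ 2 * 1 + 1 * real (peaks Q) ^ 2 + empty_indicator P * 1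
      + (real (peaks P) * real (peaks Q) + real (peaks P) * real (peaks Q))
      + (empty_indicator P * real (peaks Q) + empty_indicator P * real (peaks Q)))"
    by (rule gf_first_return_0, simp, simp only: peaks_first_return_real)
      (simp add: empty_indicator_def power2_eq_square algebra_simps)
  then show ?thesis
    by (rule trans) (simp only: pair_gf_simps, algebra)
qed

lemma area_sq_gf_eq:
  "area_sq_gf = fps_X * (area_sq_gf * count_gf + count_gf * area_sq_gf
     + euler (euler count_gf) * count_gf + 2 * (area_gf * area_gf)
     + 2 * (euler area_gf * count_gf) + 2 * (euler count_gf * area_gf))"
proof -
  have "area_sq_gf = fps_X * pair_gf (\<lambda>P Q.
      real (area P) ^ 2 * 1 + 1 * real (area Q) ^ 2
      + (real (count_list P North) * real (count_list P North)) * 1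
      + (real (area P) * real (area Q) + real (area P) * real (area Q))
      + ((real (count_list P North) * real (area P)) * 1 + (real (count_list P North) * real (area P)) * 1)
      + (real (count_list P North) * real (area Q) + real (count_list P North) * real (area Q)))"
    by (rule gf_first_return_0, simp add: area_Nil, simp only: area_first_return_real)
      (simp add: power2_eq_square algebra_simps)
  then show ?thesis
    by (rule trans) (simp only: pair_gf_simps, algebra)
qed

text \<open>Here \<open>empty_indicator P\<close> only survives in the product with the area of \<open>Q\<close>, since the empty
  path has half-length and area zero.\<close>

lemma area_peaks_gf_eq:
  "area_peaks_gf = fps_X * (area_peaks_gf * count_gf + count_gf * area_peaks_gf
     + 2 * (area_gf * peaks_gf) + euler peaks_gf * count_gf + euler count_gf * peaks_gf + area_gf)"
proof -
  have "area_peaks_gf = fps_X * pair_gf (\<lambda>P Q.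
      (real (area P) * real (peaks P)) * 1 + 1 * (real (area Q) * real (peaks Q))
      + (real (area P) * real (peaks Q) + real (peaks P) * real (area Q))
      + (real (count_list P North) * real (peaks P)) * 1
      + real (count_list P North) * real (peaks Q) + empty_indicator P * real (area Q))"
    by (rule gf_first_return_0, simp add: area_Nil, simp only: area_first_return_real peaks_first_return_real)
      (simp add: area_Nil empty_indicator_def algebra_simps)
  then show ?thesis
    by (rule trans) (simp only: pair_gf_simps, algebra)
qed

section \<open>Powers of \<open>1 - 4x\<close>\<close>

text \<open>The binomial series of \<open>(1 - 4x)\<^sup>a\<close>.\<close>

definition pow_series :: "real \<Rightarrow> real fps" where
  "pow_series a = Abs_fps (\<lambda>n. (- 4) ^ n * (a gchoose n))"

lemma pow_series_add: "pow_series (a + b) = pow_series a * pow_series b"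
proof (rule fps_ext)
  fix n
  have "(pow_series a * pow_series b) $ n =
      (\<Sum>k=0..n. (- 4) ^ n * ((a gchoose k) * (b gchoose (n - k))))"
    unfolding fps_mult_nth
  proof (intro sum.cong refl)
    fix k assume "k \<in> {0..n}"
    then have "(- 4 :: real) ^ n = (- 4) ^ k * (- 4) ^ (n - k)"
      by (simp flip: power_add)
    then show "pow_series a $ k * pow_series b $ (n - k) =
        (- 4) ^ n * ((a gchoose k) * (b gchoose (n - k)))"
      by (simp add: pow_series_def)
  qed
  then show "pow_series (a + b) $ n = (pow_series a * pow_series b) $ n"
    by (simp add: pow_series_def gbinomial_Vandermonde flip: sum_distrib_left)
qed

lemma pow_series_0: "pow_series 0 = 1"
  by (rule fps_ext) (auto simp: pow_series_def gbinomial_0_left)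

lemma pow_series_1: "pow_series 1 = 1 - 4 * fps_X"
proof (rule fps_ext)
  fix n show "pow_series 1 $ n = (1 - 4 * fps_X) $ n"
    using binomial_gbinomial[of 1 n, where 'a = real]
    by (cases n rule: nat.exhaust; cases "n - 1")
      (auto simp: pow_series_def numeral_fps_const)
qed

lemma pow_series_power: "pow_series a ^ k = pow_series (real k * a)"
  by (induction k) (simp_all add: pow_series_0 distrib_right flip: pow_series_add)

text \<open>Lowers the exponent by one, so that the coefficients for \<open>a = -1/2\<close> and \<open>a = -1\<close> determine
  those of all negative powers of \<open>s\<close>.\<close>

lemma pow_series_lower_nth:
  "a * pow_series (a - 1) $ n = (a - real n) * pow_series a $ n"
  using gbinomial_absorb_comp[of a n] by (simp add: pow_series_def)

text \<open>This is \<open>4\<^sup>n / binom(2n, n)\<close>; its square is \<open>2n + 1\<close> times the \<open>n\<close>th partial product of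
  Wallis' formula for \<open>\<pi>/2\<close>.\<close>

definition wallis_ratio :: "nat \<Rightarrow> real" where
  "wallis_ratio n = (\<Prod>k=1..n. 2 * real k / (2 * real k - 1))"

lemma wallis_ratio_Suc:
  "wallis_ratio (Suc n) = wallis_ratio n * (2 * real n + 2) / (2 * real n + 1)"
  by (simp add: wallis_ratio_def algebra_simps)

lemma wallis_ratio_pos: "wallis_ratio n > 0"
  unfolding wallis_ratio_def by (intro prod_pos) auto

text \<open>The series \<open>s = sqrt (1 - 4x)\<close> and its inverse. Solutions are stated as polynomials in these two,
  so that \<open>x\<close> and the Catalan series are eliminated.\<close>

abbreviation rt :: "real fps" where "rt \<equiv> pow_series (1 / 2)"
abbreviation irt :: "real fps" where "irt \<equiv> pow_series (- (1 / 2))"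

lemma rt_irt: "rt * irt = 1"
  using pow_series_add[of "1 / 2" "- (1 / 2)"] by (simp add: pow_series_0)

lemma rt_rt: "rt * rt = 1 - 4 * fps_X"
  using pow_series_add[of "1 / 2" "1 / 2"] by (simp add: pow_series_1)

text \<open>All coefficients needed later are rational functions of \<open>n\<close> times either \<open>4\<^sup>n\<close> or this
  coefficient, so the moments are rational in \<open>n\<close> and \<open>wallis_ratio n\<close>.\<close>

lemma irt_nth: "irt $ n = 4 ^ n / wallis_ratio n"
proof (induction n)
  case 0
  then show ?case by (simp add: pow_series_def wallis_ratio_def)
next
  case (Suc n)
  have "irt $ Suc n * real (Suc n) = (- 4) ^ Suc n * (real (Suc n) * ((- (1 / 2)) gchoose Suc n))"
    by (simp add: pow_series_def)
  also have "real (Suc n) * ((- (1 / 2)) gchoose Suc n) = (- (1 / 2) - real n) * ((- (1 / 2)) gchoose n)"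
    using gbinomial_mult_1[of "- (1 / 2) :: real" n] by (simp add: algebra_simps)
  also have "(- 4) ^ Suc n * \<dots> = - 4 * (- (1 / 2) - real n) * irt $ n"
    by (simp add: pow_series_def algebra_simps)
  finally have "irt $ Suc n * real (Suc n) = - 4 * (- (1 / 2) - real n) * irt $ n" .
  then have "irt $ Suc n = (2 * (2 * real n + 1)) / (real n + 1) * irt $ n"
    by (simp add: field_simps)
  also have "\<dots> = 4 ^ Suc n / wallis_ratio (Suc n)"
    using wallis_ratio_pos[of n] by (simp add: Suc wallis_ratio_Suc divide_simps) algebra
  finally show ?case .
qed

lemma rt_nth: "rt $ n = - (irt $ n) / (2 * real n - 1)"
proof -
  have "real (2 * n) \<noteq> real 1" by (subst of_nat_eq_iff) presburger
  then have "2 * real n - 1 \<noteq> 0" by simp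
  then show ?thesis
    using pow_series_lower_nth[of "1 / 2" n] by (simp add: field_simps)
qed

lemma irt_power_nth:
  shows "(irt ^ 2) $ n = 4 ^ n"
    and "(irt ^ 3) $ n = (2 * real n + 1) * irt $ n"
    and "(irt ^ 4) $ n = (real n + 1) * 4 ^ n"
    and "(irt ^ 5) $ n = (2 * real n + 1) * (2 * real n + 3) / 3 * irt $ n"
proof -
  have p: "irt ^ 2 = pow_series (- 1)" "irt ^ 3 = pow_series (- (3 / 2))"
    "irt ^ 4 = pow_series (- 2)" "irt ^ 5 = pow_series (- (5 / 2))"
    by (simp_all add: pow_series_power)
  have "((- 1 :: real) gchoose n) = (- 1) ^ n"
    using gbinomial_minus[of "1 :: real" n] by (simp flip: binomial_gbinomial)
  then show 2: "(irt ^ 2) $ n = 4 ^ n"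
    unfolding p by (simp add: pow_series_def flip: power_mult_distrib)
  show 3: "(irt ^ 3) $ n = (2 * real n + 1) * irt $ n"
    using pow_series_lower_nth[of "- (1 / 2)" n] by (simp add: p field_simps)
  show "(irt ^ 4) $ n = (real n + 1) * 4 ^ n"
    using pow_series_lower_nth[of "- 1" n] 2 by (simp add: p field_simps)
  show "(irt ^ 5) $ n = (2 * real n + 1) * (2 * real n + 3) / 3 * irt $ n"
    using pow_series_lower_nth[of "- (3 / 2)" n] 3 by (simp add: p field_simps)
qed

section \<open>The generating functions in closed form\<close>

lemma euler_add: "euler (F + G) = euler F + euler G"
  and euler_diff: "euler (F - G) = euler F - euler G"
  and euler_mult: "euler (F * G) = euler F * G + F * euler G"
  and euler_numeral: "euler (numeral w) = 0"
  and euler_1: "euler 1 = 0"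
  by (simp_all add: euler_def algebra_simps numeral_fps_const)

lemma euler_X: "euler fps_X = fps_X"
  by (simp add: euler_def)

lemma euler_rt: "2 * euler rt = rt - irt"
proof -
  have "euler rt * rt + rt * euler rt = - 4 * fps_X"
    using euler_mult[of rt rt] by (simp add: rt_rt euler_def numeral_fps_const)
  then show ?thesis using rt_rt rt_irt by algebra
qed

lemma euler_irt: "2 * euler irt = irt ^ 3 - irt"
proof -
  have "euler rt * irt + rt * euler irt = 0"
    using euler_mult[of rt irt] by (simp add: rt_irt euler_1)
  then show ?thesis using euler_rt rt_rt rt_irt by algebra
qed

text \<open>The quadratic equation for the Catalan series says that \<open>1 - 2xC\<close> is a square root of \<open>1 - 4x\<close>;
  the constant coefficient decides the sign. In every later equation \<open>F = x (2 F C + \<dots>)\<close> this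
  value turns the unknown into \<open>s F\<close>.\<close>

lemma count_gf_closed: "2 * (fps_X * count_gf) = 1 - rt"
proof -
  have "(1 - 2 * (fps_X * count_gf)) * (1 - 2 * (fps_X * count_gf)) = rt * rt"
    using count_gf_eq rt_rt by algebra
  then have "1 - 2 * (fps_X * count_gf) = rt \<or> 1 - 2 * (fps_X * count_gf) = - rt"
    by (simp add: square_eq_iff)
  moreover have "(1 - 2 * (fps_X * count_gf)) $ 0 \<noteq> (- rt) $ 0"
    by (simp add: pow_series_def)
  ultimately show ?thesis by (metis diff_diff_eq2 add_diff_cancel_left')
qed

lemma euler_count_gf: "4 * (fps_X * euler count_gf) = irt + rt - 2"
proof -
  have "2 * euler (fps_X * count_gf) = - euler rt"
    using arg_cong[OF count_gf_closed, of euler]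
    by (simp only: euler_mult euler_numeral euler_diff euler_1) simp
  then have "2 * (fps_X * count_gf) + 2 * (fps_X * euler count_gf) = - euler rt"
    by (simp add: euler_mult euler_X distrib_left)
  then show ?thesis using count_gf_closed euler_rt by algebra
qed

lemma euler_euler_count_gf: "8 * (fps_X * euler (euler count_gf)) = irt ^ 3 - 4 * irt - rt + 4"
proof -
  have "4 * (fps_X * euler count_gf) + 4 * (fps_X * euler (euler count_gf)) = euler irt + euler rt"
    using arg_cong[OF euler_count_gf, of euler]
    by (simp add: euler_mult euler_numeral euler_diff euler_add euler_X distrib_left)
  then show ?thesis using euler_count_gf euler_rt euler_irt by algebra
qed

lemma peaks_gf_closed: "2 * peaks_gf = irt - 1"
proof -
  have "rt * (2 * peaks_gf) = 1 - rt"
    using peaks_gf_eq count_gf_closed by algebra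
  then show ?thesis using rt_irt by algebra
qed

lemma euler_peaks_gf: "4 * euler peaks_gf = irt ^ 3 - irt"
proof -
  have "2 * euler peaks_gf = euler irt"
    using arg_cong[OF peaks_gf_closed, of euler] by (simp add: euler_mult euler_numeral euler_diff euler_1)
  then have "2 * (2 * euler peaks_gf) = irt ^ 3 - irt"
    by (simp only: euler_irt)
  then show ?thesis by simp
qed

text \<open>The area series is multiplied by \<open>x\<close> because only \<open>x C\<close>, not the Catalan series \<open>C\<close> itself, is
  a polynomial in \<open>s\<close>.\<close>

lemma area_gf_closed: "8 * (fps_X * area_gf) = irt ^ 2 - 3 * irt + 3 - rt"
proof -
  have "rt * (8 * (fps_X * area_gf)) = 8 * (fps_X * euler count_gf) * (fps_X * count_gf)"
    using area_gf_eq count_gf_closed by algebra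
  also have "\<dots> = (irt + rt - 2) * (1 - rt)"
    using euler_count_gf count_gf_closed by algebra
  finally show ?thesis using rt_irt by algebra
qed

lemma euler_area_gf:
  "16 * (fps_X * euler area_gf) = 2 * irt ^ 4 - 3 * irt ^ 3 - 4 * irt ^ 2 + 10 * irt - 6 + rt"
proof -
  have "8 * (fps_X * area_gf) + 8 * (fps_X * euler area_gf) = 2 * irt * euler irt - 3 * euler irt - euler rt"
    using arg_cong[OF area_gf_closed, of euler]
    by (simp add: euler_mult euler_numeral euler_diff euler_add euler_X algebra_simps power2_eq_square)
  then show ?thesis using area_gf_closed euler_rt euler_irt by algebra
qed

lemma peaks_sq_gf_closed: "8 * peaks_sq_gf = irt ^ 3 + 2 * irt - 4 + rt"
proof -
  have "rt * (8 * peaks_sq_gf) = 4 * (1 - rt) + 4 * fps_X * ((irt - 1) * (irt - 1) + 2 * (irt - 1))"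
    using peaks_sq_gf_eq count_gf_closed peaks_gf_closed by algebra
  then show ?thesis using rt_rt rt_irt by algebra
qed

text \<open>Multiplying the equation by another \<open>x\<close> groups every factor into one of the series
  already expressed through \<open>s\<close> and its inverse.\<close>

lemma area_sq_gf_closed:
  "32 * (fps_X * area_sq_gf) =
     5 * irt ^ 5 - 12 * irt ^ 4 + irt ^ 3 + 20 * irt ^ 2 - 21 * irt + 8 - rt"
proof -
  have "rt * (32 * (fps_X * area_sq_gf)) =
      (fps_X * count_gf) * (32 * (fps_X * euler (euler count_gf))) + 64 * (fps_X * area_gf) ^ 2
      + 64 * (fps_X * euler area_gf) * (fps_X * count_gf) + 64 * (fps_X * euler count_gf) * (fps_X * area_gf)"
    using area_sq_gf_eq count_gf_closed by algebra
  also have "\<dots> = 2 * (1 - rt) * (irt ^ 3 - 4 * irt - rt + 4) + (irt ^ 2 - 3 * irt + 3 - rt) ^ 2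
     + 2 * (1 - rt) * (2 * irt ^ 4 - 3 * irt ^ 3 - 4 * irt ^ 2 + 10 * irt - 6 + rt)
     + 2 * (irt + rt - 2) * (irt ^ 2 - 3 * irt + 3 - rt)"
    unfolding euler_euler_count_gf[symmetric] area_gf_closed[symmetric] euler_area_gf[symmetric]
      euler_count_gf[symmetric] count_gf_closed[symmetric] by algebra
  finally show ?thesis using rt_irt by algebra
qed

lemma area_peaks_gf_closed:
  "8 * area_peaks_gf = 2 * irt ^ 4 - 3 * irt ^ 3 - irt ^ 2 + 3 * irt - 1"
proof -
  have "rt * (8 * area_peaks_gf) =
      (irt ^ 2 - 3 * irt + 3 - rt) * (irt - 1) + (irt ^ 3 - irt) * (1 - rt)
      + (irt + rt - 2) * (irt - 1) + (irt ^ 2 - 3 * irt + 3 - rt)"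
    using area_peaks_gf_eq count_gf_closed peaks_gf_closed area_gf_closed euler_peaks_gf euler_count_gf
    by algebra
  then show ?thesis using rt_irt by algebra
qed

section \<open>Exact moments\<close>

lemma irt_Suc_nth: "irt $ Suc n = 2 * (2 * real n + 1) / (real n + 1) * irt $ n"
  using wallis_ratio_pos[of n]
  by (simp add: irt_nth wallis_ratio_Suc divide_simps) algebra

lemma gf_X_shift: "(fps_X * F) $ Suc n = F $ n" for F :: "real fps"
  by simp

lemma numeral_fps_nth: "(numeral k * F) $ n = numeral k * F $ n" for F :: "real fps"
  by (simp add: numeral_fps_const)

lemma const_nth_Suc: "(numeral k :: real fps) $ Suc n = 0" "(1 :: real fps) $ Suc n = 0"
  by (simp_all add: numeral_fps_const)

lemma count_gf_nth: "count_gf $ n = irt $ n / (real n + 1)"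
proof -
  have "2 * real n + 1 \<noteq> 0" by linarith
  then have "2 * count_gf $ n = 2 * irt $ n / (real n + 1)"
    using arg_cong[OF count_gf_closed, of "\<lambda>F. F $ Suc n"]
    by (simp only: of_nat_Suc numeral_fps_nth gf_X_shift fps_sub_nth const_nth_Suc rt_nth irt_Suc_nth)
      (simp add: divide_simps)
  then show ?thesis by simp
qed

text \<open>The normalisation is the Catalan number \<open>irt $ n / (n + 1)\<close> from \<open>count_gf_nth\<close>.\<close>

lemma expectation_eq:
  "measure_pmf.expectation (random_dyck_path n) f = gf f $ n * (real n + 1) / irt $ n"
proof -
  have "real (card (dyck_paths n)) = irt $ n / (real n + 1)"
    using count_gf_nth[of n] by (simp add: gf_def)
  then show ?thesis
    by (simp add: random_dyck_path_def integral_pmf_of_set finite_dyck_paths dyck_paths_nonempty gf_def)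
qed

text \<open>Dividing a coefficient by \<open>w\<close> removes all exponential growth: \<open>4\<^sup>n\<close> becomes \<open>r\<close> and the
  coefficient of \<open>irt\<close> becomes \<open>1\<close>. The area series occur multiplied by \<open>x\<close>, so their
  coefficients are taken at \<open>n + 1\<close>.\<close>

context
  fixes n :: nat and r w :: real
  assumes n: "n > 0"
  defines "r \<equiv> wallis_ratio n" and "w \<equiv> irt $ n"
begin

lemma irt_n: "irt $ n = w" and four_power_n: "4 ^ n = r * w" "4 ^ Suc n = 4 * (r * w)"
  and w_pos: "w > 0"
  using wallis_ratio_pos[of n] by (simp_all add: r_def w_def irt_nth)

lemma n_nonzero: "real n + 1 \<noteq> 0" "2 * real n + 1 \<noteq> 0" "2 * real n - 1 \<noteq> 0"
proof -
  have "real (2 * n) \<noteq> real 1" by (subst of_nat_eq_iff) presburger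
  then show "2 * real n - 1 \<noteq> 0" by simp
qed linarith+

lemma const_nth_n: "(numeral k :: real fps) $ n = 0" "(1 :: real fps) $ n = 0"
  using n by (simp_all add: numeral_fps_const)

lemmas nth_simps = of_nat_Suc numeral_fps_nth gf_X_shift fps_sub_nth fps_add_nth const_nth_Suc const_nth_n
  irt_power_nth rt_nth irt_Suc_nth irt_n four_power_n

lemma expectation_peaks:
  "measure_pmf.expectation (random_dyck_path n) (\<lambda>P. real (peaks P)) =
     (real n + 1) / 2"
proof -
  have "2 * peaks_gf $ n = w - 0"
    using arg_cong[OF peaks_gf_closed, of "\<lambda>F. F $ n"] by (simp only: nth_simps)
  then have "peaks_gf $ n = w / 2" by simp
  then show ?thesis
    using w_pos by (simp add: expectation_eq irt_n divide_simps)
qed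

lemma expectation_peaks_square:
  "measure_pmf.expectation (random_dyck_path n) (\<lambda>P. real (peaks P) ^ 2) =
     (real n + 1) * (real n ^ 2 + real n - 1) / (2 * (2 * real n - 1))"
proof -
  have "8 * peaks_sq_gf $ n = (2 * real n + 1) * w + 2 * w - 0 + - w / (2 * real n - 1)"
    using arg_cong[OF peaks_sq_gf_closed, of "\<lambda>F. F $ n"] by (simp only: nth_simps)
  also have "\<dots> = w * ((2 * real n + 1) + 2 - 1 / (2 * real n - 1))"
    using n_nonzero by (simp add: divide_simps) algebra
  finally have "peaks_sq_gf $ n = w * ((2 * real n + 1) + 2 - 1 / (2 * real n - 1)) / 8" by simp
  then show ?thesis
    using w_pos n_nonzero by (simp add: expectation_eq irt_n divide_simps) algebra
qed

lemma expectation_area: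
  "measure_pmf.expectation (random_dyck_path n) (\<lambda>P. real (area P)) =
     (real n + 1) * r / 2 - (3 * real n + 1) / 2"
proof -
  have "8 * area_gf $ n = 4 * (r * w) - 3 * (2 * (2 * real n + 1) / (real n + 1) * w)
      + 0 - - (2 * (2 * real n + 1) / (real n + 1) * w) / (2 * (1 + real n) - 1)"
    using arg_cong[OF area_gf_closed, of "\<lambda>F. F $ Suc n"] by (simp only: nth_simps)
  also have "\<dots> = w * (4 * r - 2 * (6 * real n + 2) / (real n + 1))"
    using n_nonzero by (simp add: divide_simps) algebra
  finally have "area_gf $ n = w * (4 * r - 2 * (6 * real n + 2) / (real n + 1)) / 8" by simp
  then show ?thesis
    using w_pos n_nonzero by (simp add: expectation_eq irt_n divide_simps) algebra
qed

lemma expectation_area_square: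
  "measure_pmf.expectation (random_dyck_path n) (\<lambda>P. real (area P) ^ 2) =
     (5 * real n ^ 3 + 24 * real n ^ 2 + 16 * real n + 3) / 6
     - (real n + 1) * (3 * real n + 1) * r / 2"
proof -
  have "32 * area_sq_gf $ n =
      5 * ((2 * (1 + real n) + 1) * (2 * (1 + real n) + 3) / 3
        * (2 * (2 * real n + 1) / (real n + 1) * w))
      - 12 * (((1 + real n) + 1) * (4 * (r * w)))
      + (2 * (1 + real n) + 1) * (2 * (2 * real n + 1) / (real n + 1) * w)
      + 20 * (4 * (r * w)) - 21 * (2 * (2 * real n + 1) / (real n + 1) * w)
      + 0 - - (2 * (2 * real n + 1) / (real n + 1) * w) / (2 * (1 + real n) - 1)"
    using arg_cong[OF area_sq_gf_closed, of "\<lambda>F. F $ Suc n"] by (simp only: nth_simps)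
  also have "\<dots> = w * (16 * (5 * real n ^ 3 + 24 * real n ^ 2 + 16 * real n + 3) / (3 * (real n + 1))
      - 16 * (3 * real n + 1) * r)"
    using n_nonzero by (simp add: divide_simps) algebra
  finally have "area_sq_gf $ n =
      w * (16 * (5 * real n ^ 3 + 24 * real n ^ 2 + 16 * real n + 3) / (3 * (real n + 1))
      - 16 * (3 * real n + 1) * r) / 32" by simp
  then show ?thesis
    using w_pos n_nonzero by (simp add: expectation_eq irt_n divide_simps) algebra
qed

lemma expectation_area_peaks:
  "measure_pmf.expectation (random_dyck_path n) (\<lambda>P. real (area P) * real (peaks P)) =
     (real n + 1) * ((2 * real n + 1) * r / 8 - 3 * real n / 4)"
proof -
  have "8 * area_peaks_gf $ n = 2 * ((real n + 1) * (r * w)) - 3 * ((2 * real n + 1) * w) - r * w + 3 * w - 0"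
    using arg_cong[OF area_peaks_gf_closed, of "\<lambda>F. F $ n"] by (simp only: nth_simps)
  also have "\<dots> = w * ((2 * real n + 1) * r - 6 * real n)"
    by algebra
  finally have "area_peaks_gf $ n = w * ((2 * real n + 1) * r - 6 * real n) / 8" by simp
  then show ?thesis
    using w_pos n_nonzero by (simp add: expectation_eq irt_n divide_simps)
qed

lemma integrable_random_dyck_path: "integrable (measure_pmf (random_dyck_path n)) f"
  for f :: "step list \<Rightarrow> real"
  by (rule integrable_measure_pmf_finite)
    (simp add: random_dyck_path_def finite_dyck_paths dyck_paths_nonempty)

lemma variance_peaks:
  "measure_pmf.variance (random_dyck_path n) (\<lambda>P. real (peaks P)) =
     (real n + 1) * (real n - 1) / (4 * (2 * real n - 1))"
  using n_nonzero
  by (subst measure_pmf.variance_eq)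
    (simp_all add: integrable_random_dyck_path expectation_peaks expectation_peaks_square
      divide_simps, algebra)

text \<open>The terms linear in \<open>r\<close> in the second moment and in the squared mean agree and cancel.\<close>

lemma variance_area:
  "measure_pmf.variance (random_dyck_path n) (\<lambda>P. real (area P)) =
     (real n + 1) * (2 * real n + 1) * (5 * real n + 3) / 12 - (real n + 1) ^ 2 * r ^ 2 / 4"
  by (subst measure_pmf.variance_eq)
    (simp_all add: integrable_random_dyck_path expectation_area expectation_area_square
      divide_simps, algebra)

text \<open>The terms of order \<open>n\<^sup>2 r\<close> and \<open>n\<^sup>2\<close> cancel between the mixed moment and the product of the
  means; this is why the correlation decays.\<close>

lemma covariance_area_peaks:
  "covariance (random_dyck_path n) (\<lambda>P. real (area P)) (\<lambda>P. real (peaks P)) =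
     - (real n + 1) * (r - 2) / 8"
proof -
  let ?E = "measure_pmf.expectation (random_dyck_path n)"
  have "?E (\<lambda>P. (real (area P) - a) * (real (peaks P) - b)) =
      ?E (\<lambda>P. real (area P) * real (peaks P)) - a * ?E (\<lambda>P. real (peaks P))
      - b * ?E (\<lambda>P. real (area P)) + a * b" for a b
  proof -
    have "?E (\<lambda>P. (real (area P) - a) * (real (peaks P) - b)) =
        ?E (\<lambda>P. real (area P) * real (peaks P) - a * real (peaks P) - b * real (area P) + a * b)"
      by (simp add: algebra_simps)
    then show ?thesis by (simp add: integrable_random_dyck_path)
  qed
  then have "covariance (random_dyck_path n) (\<lambda>P. real (area P)) (\<lambda>P. real (peaks P)) =
      ?E (\<lambda>P. real (area P) * real (peaks P))
      - ?E (\<lambda>P. real (area P)) * ?E (\<lambda>P. real (peaks P))"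
    by (simp add: covariance_def)
  then show ?thesis
    by (simp add: expectation_area expectation_peaks expectation_area_peaks field_simps)
qed

end

section \<open>Asymptotics\<close>

text \<open>With the partial Wallis product \<open>W\<close>, the square is \<open>(2n + 1) W n\<close>. Now \<open>W\<close> increases to \<open>\<pi>/2\<close>,
  which gives the upper bound, while \<open>(2n + 1) W n / n\<close> decreases to \<open>\<pi>\<close>, which gives the lower
  one.\<close>

lemma wallis_ratio_bounds:
  assumes "n > 0"
  shows "pi * real n \<le> wallis_ratio n ^ 2" "wallis_ratio n ^ 2 \<le> pi * (real n + 1 / 2)"
proof -
  define W where "W n = (\<Prod>k=1..n. (4 * real k ^ 2) / (4 * real k ^ 2 - 1))" for n
  have W: "W \<longlonglongrightarrow> pi / 2" unfolding W_def by (rule wallis)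
  have step: "W (Suc n) = W n * ((2 * real n + 2) ^ 2 / ((2 * real n + 1) * (2 * real n + 3)))" for n
    by (simp add: W_def algebra_simps power2_eq_square)
  have sq: "wallis_ratio n ^ 2 = (2 * real n + 1) * W n" for n
  proof (induction n)
    case 0
    show ?case by (simp add: wallis_ratio_def W_def)
  next
    case (Suc n)
    \<comment> \<open>the square of \<open>(2k) / (2k - 1)\<close> is the Wallis factor times \<open>(2k + 1) / (2k - 1)\<close>, which telescopes\<close>
    have "2 * real n + 1 \<noteq> 0" "2 * real n + 3 \<noteq> 0" by linarith+
    then have "(2 * real n + 1) * W n * (2 * real n + 2) ^ 2 / (2 * real n + 1) ^ 2 =
        (2 * real n + 3) * (W n * ((2 * real n + 2) ^ 2 / ((2 * real n + 1) * (2 * real n + 3))))"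
      by (simp add: divide_simps) algebra
    moreover have "wallis_ratio (Suc n) ^ 2 =
        (2 * real n + 1) * W n * (2 * real n + 2) ^ 2 / (2 * real n + 1) ^ 2"
      by (simp add: wallis_ratio_Suc power_mult_distrib power_divide Suc)
    moreover have "2 * real (Suc n) + 1 = 2 * real n + 3" by simp
    ultimately show ?case by (simp only: step)
  qed
  have pos: "W n > 0" for n
    using sq[of n] wallis_ratio_pos[of n] by (metis add_pos_nonneg zero_less_mult_pos mult_nonneg_nonneg
      of_nat_0_le_iff zero_less_one zero_le_numeral add.commute zero_less_power)
  have "incseq W"
  proof (rule incseq_SucI)
    fix n
    have "(2 * real n + 1) * (2 * real n + 3) > 0" by (intro mult_pos_pos) auto
    then have "(2 * real n + 2) ^ 2 / ((2 * real n + 1) * (2 * real n + 3)) \<ge> 1"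
      by (subst le_divide_eq_1_pos) (simp_all add: algebra_simps power2_eq_square)
    then have "W n * 1 \<le> W (Suc n)"
      unfolding step using pos[of n] by (intro mult_left_mono) auto
    then show "W n \<le> W (Suc n)" by simp
  qed
  then have "W n \<le> pi / 2" using W by (rule incseq_le)
  then have "(2 * real n + 1) * W n \<le> (2 * real n + 1) * (pi / 2)"
    by (intro mult_left_mono) auto
  then show "wallis_ratio n ^ 2 \<le> pi * (real n + 1 / 2)"
    by (simp add: sq algebra_simps)
  \<comment> \<open>the quotient of the square by \<open>n\<close> at \<open>n = m + 1\<close>, which avoids division by zero at the start\<close>
  define V where "V m = (2 + 1 / real (Suc m)) * W (Suc m)" for m
  have "decseq V"
  proof (rule decseq_SucI)
    fix m
    have eq: "(2 + 1 / real (Suc (Suc m)))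
          * ((2 * real (Suc m) + 2) ^ 2 / ((2 * real (Suc m) + 1) * (2 * real (Suc m) + 3)))
       \<le> 2 + 1 / real (Suc m)"
      by (simp add: divide_simps) (simp add: algebra_simps power2_eq_square)
    have "V (Suc m) =
        W (Suc m) * ((2 + 1 / real (Suc (Suc m)))
          * ((2 * real (Suc m) + 2) ^ 2 / ((2 * real (Suc m) + 1) * (2 * real (Suc m) + 3))))"
      by (simp only: V_def step[of "Suc m"] mult_ac)
    also have "\<dots> \<le> W (Suc m) * (2 + 1 / real (Suc m))"
      using pos[of "Suc m"] eq by (intro mult_left_mono) auto
    finally show "V (Suc m) \<le> V m" by (simp add: V_def mult_ac)
  qed
  moreover have "V \<longlonglongrightarrow> (2 + 0) * (pi / 2)"
    unfolding V_def by (intro tendsto_intros LIMSEQ_Suc[OF W] LIMSEQ_Suc[OF lim_1_over_n])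
  ultimately have "(2 + 0) * (pi / 2) \<le> V (n - 1)" by (rule decseq_ge)
  also have "\<dots> = wallis_ratio n ^ 2 / real n"
    using assms by (simp add: V_def sq field_simps)
  finally show "pi * real n \<le> wallis_ratio n ^ 2"
    using assms by (simp add: field_simps)
qed

text \<open>The map \<open>t \<mapsto> 1 / sqrt t\<close> is differentiable at \<open>c > 0\<close> and hence preserves rates of
  convergence.\<close>

lemma bigo_inverse_sqrt:
  fixes f :: "nat \<Rightarrow> real"
  assumes f: "(\<lambda>n. f n - c) \<in> O(g)" and g: "g \<longlonglongrightarrow> 0" and c: "c > 0"
  shows "(\<lambda>n. 1 / sqrt (f n) - 1 / sqrt c) \<in> O(g)"
proof -
  have "g \<in> o(\<lambda>_. 1)" using g by (intro smalloI_tendsto) auto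
  with f have "(\<lambda>n. f n - c) \<in> o(\<lambda>_. 1)" by (rule landau_o.big_small_trans)
  then have "(\<lambda>n. f n - c) \<longlonglongrightarrow> 0" by (auto dest: smalloD_tendsto)
  then have lim: "f \<longlonglongrightarrow> c" by (simp add: LIM_zero_iff)
  have "((\<lambda>n. - 1 / (sqrt (f n) * sqrt c * (sqrt (f n) + sqrt c)))
      \<longlonglongrightarrow> - 1 / (sqrt c * sqrt c * (sqrt c + sqrt c)))"
    using c by (intro tendsto_intros lim) auto
  then have "(\<lambda>n. - 1 / (sqrt (f n) * sqrt c * (sqrt (f n) + sqrt c))) \<in> O(\<lambda>_. 1)"
    by (intro bigoI_tendsto[where c = "- 1 / (sqrt c * sqrt c * (sqrt c + sqrt c))"]) auto
  then have "(\<lambda>n. (f n - c) * (- 1 / (sqrt (f n) * sqrt c * (sqrt (f n) + sqrt c)))) \<in> O(\<lambda>n. g n * 1)"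
    by (rule landau_o.big.mult[OF f])
  moreover have "eventually (\<lambda>n. 1 / sqrt (f n) - 1 / sqrt c =
      (f n - c) * (- 1 / (sqrt (f n) * sqrt c * (sqrt (f n) + sqrt c)))) sequentially"
  proof -
    have "eventually (\<lambda>n. f n > 0) sequentially"
      using lim c by (rule order_tendstoD)
    then show ?thesis
    proof eventually_elim
      case (elim n)
      have diff: "f n - c = (sqrt (f n) + sqrt c) * (sqrt (f n) - sqrt c)"
        using elim c by (simp add: algebra_simps)
      have "sqrt (f n) > 0" "sqrt c > 0" using elim c by auto
      then have "sqrt (f n) + sqrt c \<noteq> 0" "sqrt (f n) \<noteq> 0" "sqrt c \<noteq> 0" by linarith+
      then show ?case unfolding diff by (simp add: divide_simps)
    qed
  qed
  ultimately show ?thesis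
    by (subst landau_o.big.in_cong[where g = "\<lambda>n. (f n - c) * (- 1 / (sqrt (f n) * sqrt c * (sqrt (f n) + sqrt c)))"])
      (assumption, simp only: mult_1_right)
qed

lemma wallis_ratio_sq_asymp: "(\<lambda>n. wallis_ratio n ^ 2 - pi * real n) \<in> O(\<lambda>_. 1)"
proof (rule bigoI[where c = "pi / 2"])
  show "eventually (\<lambda>n. norm (wallis_ratio n ^ 2 - pi * real n) \<le> pi / 2 * norm (1 :: real)) sequentially"
    using eventually_gt_at_top[of 0]
  proof eventually_elim
    case (elim n)
    show ?case using wallis_ratio_bounds[OF elim] by (simp add: algebra_simps)
  qed
qed

lemma wallis_ratio_asymp: "(\<lambda>n. wallis_ratio n - sqrt (pi * real n)) \<in> O(\<lambda>_. 1)"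
proof (rule bigoI[where c = "sqrt (pi / 2)"])
  show "eventually (\<lambda>n. norm (wallis_ratio n - sqrt (pi * real n)) \<le> sqrt (pi / 2) * norm (1 :: real)) sequentially"
    using eventually_gt_at_top[of 0]
  proof eventually_elim
    case (elim n)
    note b = wallis_ratio_bounds[OF elim]
    have "sqrt (pi * real n) \<le> wallis_ratio n"
      using b(1) wallis_ratio_pos[of n] by (intro real_le_lsqrt) auto
    moreover have "wallis_ratio n \<le> sqrt (pi * (real n + 1 / 2))"
      using b(2) by (rule real_le_rsqrt)
    moreover have "sqrt (pi * (real n + 1 / 2)) \<le> sqrt (pi * real n) + sqrt (pi / 2)"
      using sqrt_add_le_add_sqrt[of "pi * real n" "pi / 2"] by (simp add: algebra_simps)
    ultimately show ?case by simp
  qed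
qed

text \<open>Already the fifth Wallis quotient is below \<open>10/3\<close>, and these quotients decrease to \<open>\<pi>\<close>.\<close>

lemma pi_less_10_3: "pi < 10 / 3"
proof -
  have "wallis_ratio 5 = 256 / 63"
    by (simp add: wallis_ratio_def eval_nat_numeral)
  then have "pi * 5 \<le> (256 / 63) ^ 2"
    using wallis_ratio_bounds(1)[of 5] by (simp only:) simp
  then show ?thesis by (simp add: power2_eq_square)
qed

text \<open>The negated covariance divided by \<open>n\<^bsup>3/2\<^esup>\<close>, and below it the product of the variances divided by
  \<open>n\<^sup>4\<close>: the scalings under which both have a finite positive limit.\<close>

definition neg_scaled_cov :: "nat \<Rightarrow> real" where
  "neg_scaled_cov n = (real n + 1) / (8 * (real n * sqrt (real n))) * (wallis_ratio n - 2)"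

definition scaled_var_prod :: "nat \<Rightarrow> real" where
  "scaled_var_prod n =
     ((real n + 1) * (2 * real n + 1) * (5 * real n + 3) / 12 - (real n + 1) ^ 2 * wallis_ratio n ^ 2 / 4)
     * ((real n + 1) * (real n - 1) / (4 * (2 * real n - 1)) / real n ^ 4)"

text \<open>Replacing \<open>r\<close> by \<open>sqrt (\<pi> n)\<close> leaves an explicit function of \<open>n\<close>; the replacement costs a bounded
  error times a factor of order \<open>n\<^bsup>-1/2\<^esup>\<close>.\<close>

lemma neg_scaled_cov_asymp:
  "(\<lambda>n. neg_scaled_cov n - sqrt pi / 8) \<in> O(\<lambda>n. 1 / sqrt (real n))"
proof -
  define z where "z n = (real n + 1) / (8 * (real n * sqrt (real n)))" for n :: nat
  have "(\<lambda>n. z n * (sqrt (pi * real n) - 2) - sqrt pi / 8) \<in> O(\<lambda>n. 1 / sqrt (real n))"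
    unfolding z_def real_sqrt_mult by real_asymp
  moreover have "(\<lambda>n. z n * (wallis_ratio n - sqrt (pi * real n))) \<in> O(\<lambda>n. 1 / sqrt (real n) * 1)"
    by (rule landau_o.big.mult[OF _ wallis_ratio_asymp]) (unfold z_def, real_asymp)
  ultimately have "(\<lambda>n. (z n * (sqrt (pi * real n) - 2) - sqrt pi / 8)
      + z n * (wallis_ratio n - sqrt (pi * real n))) \<in> O(\<lambda>n. 1 / sqrt (real n))"
    unfolding mult_1_right by (rule sum_in_bigo(1))
  moreover have "(z n * (sqrt (pi * real n) - 2) - sqrt pi / 8)
      + z n * (wallis_ratio n - sqrt (pi * real n)) = neg_scaled_cov n - sqrt pi / 8" for n
    unfolding neg_scaled_cov_def z_def[symmetric] by (simp add: algebra_simps)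
  ultimately show ?thesis by (simp only:)
qed

text \<open>As for the covariance, now with \<open>r\<^sup>2\<close> replaced by \<open>\<pi> n\<close>.\<close>

lemma scaled_var_prod_asymp:
  "(\<lambda>n. scaled_var_prod n - (5 / 6 - pi / 4) / 8) \<in> O(\<lambda>n. 1 / sqrt (real n))"
proof -
  define A where "A n = (real n + 1) * (2 * real n + 1) * (5 * real n + 3) / 12" for n :: nat
  define V where "V n = (real n + 1) * (real n - 1) / (4 * (2 * real n - 1)) / real n ^ 4" for n :: nat
  have "(\<lambda>n. (A n - (real n + 1) ^ 2 * (pi * real n) / 4) * V n - (5 / 6 - pi / 4) / 8)
      \<in> O(\<lambda>n. 1 / sqrt (real n))"
    unfolding A_def V_def by real_asymp
  moreover have "(\<lambda>n. (real n + 1) ^ 2 / 4 * V n * (wallis_ratio n ^ 2 - pi * real n))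
      \<in> O(\<lambda>n. 1 / sqrt (real n) * 1)"
    by (rule landau_o.big.mult[OF _ wallis_ratio_sq_asymp]) (unfold V_def, real_asymp)
  ultimately have "(\<lambda>n. ((A n - (real n + 1) ^ 2 * (pi * real n) / 4) * V n - (5 / 6 - pi / 4) / 8)
      - (real n + 1) ^ 2 / 4 * V n * (wallis_ratio n ^ 2 - pi * real n)) \<in> O(\<lambda>n. 1 / sqrt (real n))"
    unfolding mult_1_right by (rule sum_in_bigo(2))
  moreover have "(a - s * p / 4) * v - c - s / 4 * v * (w - p) = (a - s * w / 4) * v - c"
    for a s w v c p :: real
    by (simp add: field_simps)
  then have "((A n - (real n + 1) ^ 2 * (pi * real n) / 4) * V n - (5 / 6 - pi / 4) / 8)
      - (real n + 1) ^ 2 / 4 * V n * (wallis_ratio n ^ 2 - pi * real n)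
      = scaled_var_prod n - (5 / 6 - pi / 4) / 8" for n
    unfolding scaled_var_prod_def A_def[symmetric] V_def[symmetric] .
  ultimately show ?thesis by (simp only:)
qed

lemma bigo_mult_limits:
  fixes f g :: "nat \<Rightarrow> real"
  assumes f: "(\<lambda>n. f n - a) \<in> O(h)" and g: "(\<lambda>n. g n - b) \<in> O(h)" and h: "h \<in> O(\<lambda>_. 1)"
  shows "(\<lambda>n. f n * g n - a * b) \<in> O(h)"
proof -
  have "(\<lambda>n. (f n - a) * (g n - b)) \<in> O(\<lambda>n. h n * 1)"
    using f landau_o.big_trans[OF g h] by (rule landau_o.big.mult)
  then have "(\<lambda>n. (f n - a) * (g n - b) + (a * (g n - b) + b * (f n - a))) \<in> O(h)"
    using f g by (intro sum_in_bigo) auto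
  then show ?thesis by (simp add: algebra_simps)
qed

lemma correlation_eq:
  assumes "n > 0"
  shows "correlation (random_dyck_path n) (\<lambda>P. real (area P)) (\<lambda>P. real (peaks P)) =
    - (neg_scaled_cov n * (1 / sqrt (scaled_var_prod n))) / sqrt (real n)"
proof -
  define S where "S = sqrt (measure_pmf.variance (random_dyck_path n) (\<lambda>P. real (area P)) *
      measure_pmf.variance (random_dyck_path n) (\<lambda>P. real (peaks P)))"
  \<comment> \<open>in terms of \<open>x\<close>, all powers of \<open>n\<close> become integral powers\<close>
  define x where "x = sqrt (real n)"
  have x: "x > 0" "real n = x * x"
    using assms by (simp_all add: x_def)
  have "scaled_var_prod n = measure_pmf.variance (random_dyck_path n) (\<lambda>P. real (area P)) *
      measure_pmf.variance (random_dyck_path n) (\<lambda>P. real (peaks P)) / (real n ^ 2) ^ 2"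
    unfolding variance_area[OF assms] variance_peaks[OF assms] scaled_var_prod_def by simp
  then have sd: "sqrt (scaled_var_prod n) = S / real n ^ 2"
    by (simp only: S_def real_sqrt_divide real_sqrt_abs abs_power2)
  have corr: "correlation (random_dyck_path n) (\<lambda>P. real (area P)) (\<lambda>P. real (peaks P)) =
      - (real n + 1) * (wallis_ratio n - 2) / 8 / S"
    unfolding correlation_def covariance_area_peaks[OF assms] S_def ..
  have "- a * b / 8 / S = - (a / (8 * (x * x * x)) * b * (1 / (S / (x * x) ^ 2))) / x" for a b
    using x(1) by (simp add: field_simps power2_eq_square)
  then show ?thesis
    unfolding neg_scaled_cov_def corr sd x_def[symmetric] unfolding x(2) .
qed

lemma limit_constant:
  "sqrt pi / 8 * (1 / sqrt ((5 / 6 - pi / 4) / 8)) = 1 / (sqrt 2 * sqrt (10 / (3 * pi) - 1))"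
proof -
  have "(5 / 6 - pi / 4) / 8 = pi * (10 / (3 * pi) - 1) / (4 ^ 2 * 2)"
    by (simp add: field_simps)
  then have e: "sqrt ((5 / 6 - pi / 4) / 8) = sqrt pi * sqrt (10 / (3 * pi) - 1) / (4 * sqrt 2)"
    by (simp only: real_sqrt_divide real_sqrt_mult real_sqrt_power_even) simp
  have simplify: "p / 8 * (1 / (p * k / (4 * t))) = 1 / (t * k)"
    if "p > 0" "k > 0" "t > 0" "t * t = 2" for p k t :: real
  proof -
    have "t * (4 * t) = 8" using that by simp
    then show ?thesis using that by (simp add: divide_simps)
  qed
  have "10 / (3 * pi) - 1 > 0" using pi_less_10_3 by simp
  then show ?thesis
    unfolding e by (intro simplify) auto
qed

text \<open>Multiplied by \<open>n\<^bsup>1/2\<^esup>\<close>, the correlation is \<open>- q n\<close>, where \<open>q\<close> converges to the stated constant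
  with error \<open>O(n\<^bsup>-1/2\<^esup>)\<close>.\<close>

theorem theorem1:
  shows "(\<lambda>n. correlation (random_dyck_path n)
                 (\<lambda>P. real (area P)) (\<lambda>P. real (peaks P))
              - (- (1 / (sqrt 2 * sqrt (10 / (3 * pi) - 1))) * real n powr (- 1 / 2)))
         \<in> O(\<lambda>n. 1 / real n)"
proof -
  define \<kappa> where "\<kappa> = 1 / (sqrt 2 * sqrt (10 / (3 * pi) - 1))"
  define q where "q n = neg_scaled_cov n * (1 / sqrt (scaled_var_prod n))" for n
  have g: "(\<lambda>n. 1 / sqrt (real n)) \<longlonglongrightarrow> 0" "(\<lambda>n. 1 / sqrt (real n)) \<in> O(\<lambda>_. 1)"
    by real_asymp+
  have "(\<lambda>n. 1 / sqrt (scaled_var_prod n) - 1 / sqrt ((5 / 6 - pi / 4) / 8)) \<in> O(\<lambda>n. 1 / sqrt (real n))"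
    using scaled_var_prod_asymp g(1) pi_less_10_3 by (intro bigo_inverse_sqrt) auto
  then have "(\<lambda>n. q n - \<kappa>) \<in> O(\<lambda>n. 1 / sqrt (real n))"
    unfolding q_def \<kappa>_def limit_constant[symmetric]
    using neg_scaled_cov_asymp g(2) by (intro bigo_mult_limits)
  then have "(\<lambda>n. \<kappa> - q n) \<in> O(\<lambda>n. 1 / sqrt (real n))"
    by (subst landau_o.big.uminus_in_iff[symmetric]) simp
  then have "(\<lambda>n. (\<kappa> - q n) * (1 / sqrt (real n))) \<in> O(\<lambda>n. 1 / sqrt (real n) * (1 / sqrt (real n)))"
    by (intro landau_o.big.mult) auto
  moreover have "eventually (\<lambda>n. correlation (random_dyck_path n)
      (\<lambda>P. real (area P)) (\<lambda>P. real (peaks P)) - (- \<kappa> * real n powr (- 1 / 2)) =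
      (\<kappa> - q n) * (1 / sqrt (real n))) sequentially"
    using eventually_gt_at_top[of 0]
  proof eventually_elim
    case (elim n)
    have "real n powr (- 1 / 2) = 1 / sqrt (real n)"
      using elim by (simp add: powr_minus_divide powr_half_sqrt)
    then show ?case
      by (simp add: correlation_eq[OF elim] q_def diff_divide_distrib)
  qed
  ultimately show ?thesis
    unfolding \<kappa>_def[symmetric] by (subst landau_o.big.in_cong) (assumption, simp)
qed

end
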